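(* Let $\Bbbk$ be a field, let $n\ge 1$, and let $G$ be a simple graph on the vertex set $\{x_1,\ldots,x_n\}$. Then the edge ideal $I(G)\subseteq P=\Bbbk[x_1,\ldots,x_n]$ is Gotzmann if and only if $G$ is a star.
   Context: $P=\Bbbk[x_1,\ldots,x_n]$ is the polynomial ring in $n$ variables over the field $\Bbbk$ with the standard grading. For a graded $P$-module $M$, the Hilbert function is $H(M,d)=\dim_\Bbbk M_d$, where $M_d$ is the homogeneous component of degree $d$. A homogeneous ideal $I\subseteq P$ generated in degree $d$ (i.e. generated by homogeneous elements of degree $d$; the zero ideal is allowed) is called Gotzmann (or $d$-Gotzmann) if for all homogeneous ideals $J\subseteq P$ with $H(I,d)=H(J,d)$ one has $H(I,d+1)\le H(J,d+1)$. For a simple graph $G=(V,E)$ with $V=\{x_1,\ldots,x_n\}$, the edge ideal is $I(G)=(x_ix_j \mid \{x_i,x_j\}\in E)\subset P$; it is regarded as an ideal generated in degree $2$, so "Gotzmann" for $I(G)$ means $2$-Gotzmann. A graph $G$ is called a star if there exists a vertex $x_{i_0}$ of $G$ whose degree is equal to the number of edges of $G$ (isolated vertices are allowed, and a graph with no edges is a star). *)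

theory Defs
  imports Complex_Main "HOL-Library.Poly_Mapping"
begin

section \<open>Graded polynomial ring\<close>

text \<open>
  The ring \<open>k[x\<^sub>1, \<dots>, x\<^sub>n]\<close> is the type of finitely supported functions from exponent
  vectors to \<open>k\<close>, with the convolution product.  The variables are indexed by a finite type
  \<open>'v\<close>, so \<open>n\<close> is \<open>CARD('v)\<close>, which is automatically positive.
\<close>

type_synonym ('v, 'k) mpoly = "('v \<Rightarrow>\<^sub>0 nat) \<Rightarrow>\<^sub>0 'k"

definition var :: "'v::finite \<Rightarrow> ('v, 'k::field) mpoly" where
  "var i = Poly_Mapping.single (Poly_Mapping.single i 1) 1"

definition scalar_mult :: "'k::field \<Rightarrow> ('v::finite, 'k) mpoly \<Rightarrow> ('v, 'k) mpoly" where
  "scalar_mult c f = Poly_Mapping.single 0 c * f"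

definition mon_deg :: "('v::finite \<Rightarrow>\<^sub>0 nat) \<Rightarrow> nat" where
  "mon_deg m = (\<Sum>i\<in>UNIV. Poly_Mapping.lookup m i)"

definition hom_component :: "nat \<Rightarrow> ('v::finite, 'k::field) mpoly \<Rightarrow> ('v, 'k) mpoly" where
  "hom_component d f =
     (\<Sum>m | m \<in> Poly_Mapping.keys f \<and> mon_deg m = d.
        Poly_Mapping.single m (Poly_Mapping.lookup f m))"

text \<open>As usual, 0 counts as homogeneous of every degree.\<close>

definition hom_polys :: "nat \<Rightarrow> ('v::finite, 'k::field) mpoly set" where
  "hom_polys d = {f. \<forall>m\<in>Poly_Mapping.keys f. mon_deg m = d}"

text \<open>
  Ideals are the submodules of the ring over itself: \<open>ideal.subspace I\<close> says that \<open>I\<close> is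
  an ideal, and \<open>ideal.span B\<close> is the ideal generated by \<open>B\<close>.
\<close>

global_interpretation ideal: module "(*) :: ('v::finite, 'k::field) mpoly \<Rightarrow> _ \<Rightarrow> _"
  by standard (simp_all add: algebra_simps)

global_interpretation mpoly_vs:
  vector_space "scalar_mult :: 'k::field \<Rightarrow> ('v::finite, 'k) mpoly \<Rightarrow> _"
  by standard
    (simp_all add: scalar_mult_def distrib_left distrib_right single_add mult_single flip: mult.assoc)

definition homogeneous_ideal :: "('v::finite, 'k::field) mpoly set \<Rightarrow> bool" where
  "homogeneous_ideal I \<longleftrightarrow> ideal.subspace I \<and> (\<forall>f\<in>I. \<forall>d. hom_component d f \<in> I)"

definition hilbert :: "('v::finite, 'k::field) mpoly set \<Rightarrow> nat \<Rightarrow> nat" where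
  "hilbert I d = mpoly_vs.dim (I \<inter> hom_polys d)"

definition generated_in_degree :: "nat \<Rightarrow> ('v::finite, 'k::field) mpoly set \<Rightarrow> bool" where
  "generated_in_degree d I \<longleftrightarrow> (\<exists>B \<subseteq> hom_polys d. I = ideal.span B)"

definition gotzmann :: "nat \<Rightarrow> ('v::finite, 'k::field) mpoly set \<Rightarrow> bool" where
  "gotzmann d I \<longleftrightarrow>
     homogeneous_ideal I \<and> generated_in_degree d I \<and>
     (\<forall>J :: ('v, 'k) mpoly set. homogeneous_ideal J \<and> hilbert I d = hilbert J d \<longrightarrow>
        hilbert I (Suc d) \<le> hilbert J (Suc d))"

section \<open>Graphs and edge ideals\<close>

text \<open>
  The vertex set is the whole type \<open>'v\<close>, so a graph is given by its set of edges, each of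
  them a set of two vertices.
\<close>

definition simple_graph :: "'v::finite set set \<Rightarrow> bool" where
  "simple_graph E \<longleftrightarrow> (\<forall>e\<in>E. card e = 2)"

definition vertex_degree :: "'v::finite set set \<Rightarrow> 'v \<Rightarrow> nat" where
  "vertex_degree E v = card {e \<in> E. v \<in> e}"

definition is_star :: "'v::finite set set \<Rightarrow> bool" where
  "is_star E \<longleftrightarrow> (\<exists>v. vertex_degree E v = card E)"

definition edge_ideal :: "'v::finite set set \<Rightarrow> ('v, 'k::field) mpoly set" where
  "edge_ideal E = ideal.span {var i * var j | i j. {i, j} \<in> E}"

end

theory Submission
  imports Defs "HOL-Library.FuncSet" "HOL-Library.Cardinality" "HOL-Combinatorics.Transposition"
begin

text \<open>
  Passing to leading monomials turns the Gotzmann property of a monomial ideal into a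
  question about sets of monomials: does the set \<open>S\<close> of generators have the fewest multiples by a
  variable among all sets of \<open>card S\<close> monomials of the same degree?  Adding monomials one at a time
  shows that \<open>m\<close> monomials have at least \<open>n + (n - 1) + \<dots> + (n - m + 1)\<close> multiples, with equality for
  \<open>m \<le> n\<close> multiples of one variable, in particular for stars.  A graph that is not a star contains
  two disjoint edges or a triangle, which makes the inequality strict and settles \<open>m < n\<close>.  For
  \<open>m \<ge> n\<close> one shifts edges towards a vertex \<open>v\<close>, which does not increase the number of
  multiples, until every edge that avoids \<open>v\<close> has both ends adjacent to \<open>v\<close>; then replacing an
  edge that avoids \<open>v\<close> by the square of \<open>x\<^sub>v\<close> lowers the number of multiples.
\<close>

section \<open>Monomials\<close>

lemma lookup_single_times_add:
  fixes a m :: "'v \<Rightarrow>\<^sub>0 nat" and f :: "('v \<Rightarrow>\<^sub>0 nat) \<Rightarrow>\<^sub>0 'k::comm_ring_1"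
  shows "Poly_Mapping.lookup (Poly_Mapping.single a c * f) (a + m) = c * Poly_Mapping.lookup f m"
  by (simp add: lookup_mult lookup_single when_mult)

lemma keys_single_times:
  fixes f :: "('v \<Rightarrow>\<^sub>0 nat) \<Rightarrow>\<^sub>0 'k::comm_ring_1"
  shows "Poly_Mapping.keys (Poly_Mapping.single a c * f) \<subseteq> (+) a ` Poly_Mapping.keys f"
  using keys_mult[of "Poly_Mapping.single a c" f] by (auto split: if_splits)

lemma lookup_scalar_mult [simp]:
  "Poly_Mapping.lookup (scalar_mult c f) m = c * Poly_Mapping.lookup f m"
  using lookup_single_times_add[of 0 c f m] by (simp add: scalar_mult_def)

lemma mon_deg_add [simp]: "mon_deg (a + b) = mon_deg a + mon_deg b"
  by (simp add: mon_deg_def lookup_add sum.distrib)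

lemma mon_deg_single [simp]: "mon_deg (Poly_Mapping.single i k) = k"
  by (simp add: mon_deg_def lookup_single when_def)

lemma lookup_le_mon_deg: "Poly_Mapping.lookup m i \<le> mon_deg m"
  unfolding mon_deg_def by (rule member_le_sum) auto

lemma finite_mon_deg_le: "finite {m :: 'v::finite \<Rightarrow>\<^sub>0 nat. mon_deg m \<le> d}"
proof (rule finite_imageD)
  show "finite (Poly_Mapping.lookup ` {m :: 'v \<Rightarrow>\<^sub>0 nat. mon_deg m \<le> d})"
  proof (rule finite_subset)
    show "Poly_Mapping.lookup ` {m :: 'v \<Rightarrow>\<^sub>0 nat. mon_deg m \<le> d} \<subseteq> PiE UNIV (\<lambda>_. {..d})"
      by (auto simp: PiE_def intro: order_trans[OF lookup_le_mon_deg])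
  qed (simp add: finite_PiE)
  show "inj_on Poly_Mapping.lookup {m :: 'v \<Rightarrow>\<^sub>0 nat. mon_deg m \<le> d}"
    by (rule inj_onI) (metis poly_mapping_eqI)
qed

lemma finite_mon_deg_eq: "finite {m :: 'v::finite \<Rightarrow>\<^sub>0 nat. mon_deg m = d}"
  by (rule finite_subset[OF _ finite_mon_deg_le[of d]]) auto

text \<open>The coefficients are the powers of \<open>d + 1\<close>, so bounded vectors are read as digit expansions.\<close>

lemma ex_separating_coeffs:
  assumes "finite F"
  shows "\<exists>c :: 'a \<Rightarrow> nat. \<forall>a b. (\<forall>i\<in>F. a i \<le> d \<and> b i \<le> d) \<longrightarrow>
           (\<Sum>i\<in>F. a i * c i) = (\<Sum>i\<in>F. b i * c i) \<longrightarrow> (\<forall>i\<in>F. a i = b i)"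
  using assms
proof (induction F rule: finite_induct)
  case (insert x F)
  then obtain c :: "'a \<Rightarrow> nat" where c: "\<And>a b. (\<forall>i\<in>F. a i \<le> d \<and> b i \<le> d) \<Longrightarrow>
      (\<Sum>i\<in>F. a i * c i) = (\<Sum>i\<in>F. b i * c i) \<Longrightarrow> (\<forall>i\<in>F. a i = b i)" by blast
  define c' where "c' i = (if i = x then 1 else Suc d * c i)" for i
  have sum: "(\<Sum>i\<in>insert x F. a i * c' i) = a x + Suc d * (\<Sum>i\<in>F. a i * c i)" for a :: "'a \<Rightarrow> nat"
  proof -
    have "(\<Sum>i\<in>F. a i * c' i) = (\<Sum>i\<in>F. Suc d * (a i * c i))"
      using insert.hyps by (intro sum.cong) (auto simp: c'_def algebra_simps)
    then show ?thesis
      using insert.hyps by (simp add: c'_def sum_distrib_left)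
  qed
  show ?case
  proof (intro exI[of _ c'] allI impI)
    fix a b :: "'a \<Rightarrow> nat"
    assume le: "\<forall>i\<in>insert x F. a i \<le> d \<and> b i \<le> d"
      and eq: "(\<Sum>i\<in>insert x F. a i * c' i) = (\<Sum>i\<in>insert x F. b i * c' i)"
    have eq': "a x + Suc d * (\<Sum>i\<in>F. a i * c i) = b x + Suc d * (\<Sum>i\<in>F. b i * c i)"
      using eq unfolding sum .
    from arg_cong[OF eq', of "\<lambda>s. s mod Suc d"] have 1: "a x = b x"
      using le by (simp del: mult_Suc)
    with eq' have "(\<Sum>i\<in>F. a i * c i) = (\<Sum>i\<in>F. b i * c i)"
      by (simp del: mult_Suc)
    with c[of a b] le 1 show "\<forall>i\<in>insert x F. a i = b i" by blast
  qed
qed auto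

text \<open>Serves as a monomial order: additivity preserves comparisons under multiplication by a
  monomial, and injectivity excludes ties up to degree \<open>d\<close>.\<close>

lemma ex_additive_weight:
  "\<exists>\<phi> :: ('v::finite \<Rightarrow>\<^sub>0 nat) \<Rightarrow> nat.
     (\<forall>a b. \<phi> (a + b) = \<phi> a + \<phi> b) \<and> inj_on \<phi> {m. mon_deg m \<le> d}"
proof -
  obtain c :: "'v \<Rightarrow> nat" where c: "\<And>a b. (\<forall>i. a i \<le> d \<and> b i \<le> d) \<Longrightarrow>
      (\<Sum>i\<in>UNIV. a i * c i) = (\<Sum>i\<in>UNIV. b i * c i) \<Longrightarrow> (\<forall>i. a i = b i)"
    using ex_separating_coeffs[of "UNIV :: 'v set" d] by auto
  define \<phi> where "\<phi> m = (\<Sum>i\<in>UNIV. Poly_Mapping.lookup m i * c i)" for m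
  have "\<phi> (a + b) = \<phi> a + \<phi> b" for a b
    by (simp add: \<phi>_def lookup_add algebra_simps sum.distrib)
  moreover have "inj_on \<phi> {m. mon_deg m \<le> d}"
  proof (rule inj_onI)
    fix a b assume ab: "a \<in> {m. mon_deg m \<le> d}" "b \<in> {m. mon_deg m \<le> d}" "\<phi> a = \<phi> b"
    have "\<forall>i. Poly_Mapping.lookup a i \<le> d \<and> Poly_Mapping.lookup b i \<le> d"
      using ab lookup_le_mon_deg le_trans by blast
    from c[OF this] ab(3) show "a = b" by (auto simp: \<phi>_def intro: poly_mapping_eqI)
  qed
  ultimately show ?thesis by blast
qed

section \<open>Dimension and leading monomials\<close>

definition polys_on :: "('v::finite \<Rightarrow>\<^sub>0 nat) set \<Rightarrow> ('v, 'k::field) mpoly set" where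
  "polys_on M = {f. Poly_Mapping.keys f \<subseteq> M}"

text \<open>Strict inequality against every other monomial of \<open>f\<close> makes the leading
  monomial unique even where \<phi> has ties.\<close>

definition leads_at ::
    "(('v::finite \<Rightarrow>\<^sub>0 nat) \<Rightarrow> nat) \<Rightarrow> ('v, 'k::field) mpoly \<Rightarrow> ('v \<Rightarrow>\<^sub>0 nat) \<Rightarrow> bool" where
  "leads_at \<phi> f m \<longleftrightarrow> m \<in> Poly_Mapping.keys f \<and> (\<forall>m'\<in>Poly_Mapping.keys f. m' = m \<or> \<phi> m' < \<phi> m)"

definition leads ::
    "(('v::finite \<Rightarrow>\<^sub>0 nat) \<Rightarrow> nat) \<Rightarrow> ('v, 'k::field) mpoly set \<Rightarrow> ('v \<Rightarrow>\<^sub>0 nat) set" where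
  "leads \<phi> W = {m. \<exists>f\<in>W. leads_at \<phi> f m}"

text \<open>In a vanishing combination take, among the \<open>s\<close> with nonzero scalar, one of
  largest weight. No other polynomial with nonzero scalar contains that monomial, so its coefficient
  cannot cancel.\<close>

lemma independent_of_leads:
  fixes F :: "('v::finite \<Rightarrow>\<^sub>0 nat) \<Rightarrow> ('v, 'k::field) mpoly"
  assumes "finite S" and F: "\<And>s. s \<in> S \<Longrightarrow> leads_at \<phi> (F s) s"
  shows "inj_on F S" and "mpoly_vs.independent (F ` S)"
proof -
  show inj: "inj_on F S"
  proof (rule inj_onI)
    fix s t assume "s \<in> S" "t \<in> S" "F s = F t"
    with F[of s] F[of t] show "s = t" unfolding leads_at_def by fastforce
  qed
  show "mpoly_vs.independent (F ` S)"
  proof (rule mpoly_vs.independent_if_scalars_zero)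
    fix c :: "('v, 'k) mpoly \<Rightarrow> 'k" and x
    assume "(\<Sum>x\<in>F ` S. scalar_mult (c x) x) = 0" and "x \<in> F ` S"
    then have sum: "(\<Sum>s\<in>S. scalar_mult (c (F s)) (F s)) = 0"
      by (simp add: sum.reindex[OF inj])
    have "c (F s) = 0" if "s \<in> S" for s
    proof (rule ccontr)
      assume "c (F s) \<noteq> 0"
      define T where "T = {s \<in> S. c (F s) \<noteq> 0}"
      have "finite T" "T \<noteq> {}"
        using \<open>finite S\<close> \<open>s \<in> S\<close> \<open>c (F s) \<noteq> 0\<close> by (auto simp: T_def)
      then have "Max (\<phi> ` T) \<in> \<phi> ` T" "\<forall>u\<in>T. \<phi> u \<le> Max (\<phi> ` T)"
        by simp_all
      then obtain t where t: "t \<in> T" "\<And>u. u \<in> T \<Longrightarrow> \<phi> u \<le> \<phi> t"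
        by auto
      have "0 = (\<Sum>s\<in>S. c (F s) * Poly_Mapping.lookup (F s) t)"
        using arg_cong[OF sum, of "\<lambda>p. Poly_Mapping.lookup p t"] by (simp add: lookup_sum)
      also have "\<dots> = (\<Sum>s\<in>S. if s = t then c (F t) * Poly_Mapping.lookup (F t) t else 0)"
      proof (rule sum.cong[OF refl])
        fix u assume "u \<in> S"
        show "c (F u) * Poly_Mapping.lookup (F u) t =
          (if u = t then c (F t) * Poly_Mapping.lookup (F t) t else 0)"
        proof (cases "u = t \<or> c (F u) = 0")
          case False
          then have "\<phi> u \<le> \<phi> t" using t \<open>u \<in> S\<close> by (simp add: T_def)
          then have "t \<notin> Poly_Mapping.keys (F u)"
            using F[OF \<open>u \<in> S\<close>] False unfolding leads_at_def by fastforce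
          then show ?thesis using False by (simp add: in_keys_iff)
        qed auto
      qed
      also have "\<dots> = c (F t) * Poly_Mapping.lookup (F t) t"
        using t(1) \<open>finite S\<close> by (simp add: T_def)
      finally show False
        using t(1) F[of t] by (simp add: T_def leads_at_def in_keys_iff)
    qed
    with \<open>x \<in> F ` S\<close> show "c x = 0" by auto
  qed (use \<open>finite S\<close> in auto)
qed

lemma leads_subset: "W \<subseteq> polys_on M \<Longrightarrow> leads \<phi> W \<subseteq> M"
  by (auto simp: leads_def leads_at_def polys_on_def)

text \<open>One polynomial is chosen for each leading monomial. These span \<open>W\<close> because
  subtracting a suitable multiple of the chosen polynomial cancels the leading term and leaves only
  smaller weights.\<close>

lemma dim_eq_card_leads:
  fixes W :: "('v::finite, 'k::field) mpoly set"
  assumes W: "mpoly_vs.subspace W" "W \<subseteq> polys_on M" and "finite M" and inj: "inj_on \<phi> M"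
  shows "mpoly_vs.dim W = card (leads \<phi> W)"
proof -
  let ?L = "leads \<phi> W"
  have "\<forall>s\<in>?L. \<exists>f. f \<in> W \<and> leads_at \<phi> f s" by (auto simp: leads_def)
  then obtain F where F: "\<And>s. s \<in> ?L \<Longrightarrow> F s \<in> W" "\<And>s. s \<in> ?L \<Longrightarrow> leads_at \<phi> (F s) s"
    by metis
  have LM: "?L \<subseteq> M" using leads_subset[OF W(2)] .
  have "finite ?L" using LM \<open>finite M\<close> by (rule finite_subset)
  note ind = independent_of_leads[OF this F(2)]
  have span: "f \<in> mpoly_vs.span (F ` ?L)"
    if "f \<in> W" "\<forall>m\<in>Poly_Mapping.keys f. \<phi> m < N" for f N
    using that
  proof (induction N arbitrary: f)
    case 0
    then have "Poly_Mapping.keys f = {}" by auto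
    then have "f = 0" by (metis in_keys_iff empty_iff lookup_zero poly_mapping_eqI)
    then show ?case by (simp add: mpoly_vs.span_zero)
  next
    case (Suc N)
    show ?case
    proof (cases "\<exists>m\<in>Poly_Mapping.keys f. \<phi> m = N")
      case False
      with Suc show ?thesis by (metis less_SucE)
    next
      case True
      then obtain m where m: "m \<in> Poly_Mapping.keys f" "\<phi> m = N" by blast
      have fM: "Poly_Mapping.keys f \<subseteq> M" using Suc.prems W(2) by (auto simp: polys_on_def)
      \<comment> \<open>Injectivity of \<phi> on \<open>M\<close> makes \<open>m\<close> the only
        monomial of \<open>f\<close> of weight \<open>N\<close>.\<close>
      have "leads_at \<phi> f m"
        unfolding leads_at_def using m Suc.prems fM inj
        by (metis inj_on_def less_SucE subsetD)
      then have mL: "m \<in> ?L" using Suc.prems by (auto simp: leads_def)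
      define c where "c = Poly_Mapping.lookup f m / Poly_Mapping.lookup (F m) m"
      define g where "g = f - scalar_mult c (F m)"
      have nz: "Poly_Mapping.lookup (F m) m \<noteq> 0"
        using F(2)[OF mL] by (simp add: leads_at_def in_keys_iff)
      have "g \<in> W"
        unfolding g_def using W(1) F(1)[OF mL] Suc.prems(1)
        by (intro mpoly_vs.subspace_diff mpoly_vs.subspace_scale)
      moreover have "\<forall>m'\<in>Poly_Mapping.keys g. \<phi> m' < N"
      proof
        fix m' assume m': "m' \<in> Poly_Mapping.keys g"
        have "m' \<noteq> m"
          using m' nz by (auto simp: g_def c_def in_keys_iff lookup_minus)
        have "m' \<in> Poly_Mapping.keys f \<or> m' \<in> Poly_Mapping.keys (F m)"
          using m' by (auto simp: g_def in_keys_iff lookup_minus)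
        with \<open>leads_at \<phi> f m\<close> F(2)[OF mL] \<open>m' \<noteq> m\<close> m(2) show "\<phi> m' < N"
          unfolding leads_at_def by blast
      qed
      ultimately have "g \<in> mpoly_vs.span (F ` ?L)" by (rule Suc.IH)
      moreover have "scalar_mult c (F m) \<in> mpoly_vs.span (F ` ?L)"
        using mL by (intro mpoly_vs.span_scale mpoly_vs.span_base) auto
      ultimately have "g + scalar_mult c (F m) \<in> mpoly_vs.span (F ` ?L)"
        by (rule mpoly_vs.span_add)
      then show ?thesis by (simp add: g_def)
    qed
  qed
  have "W \<subseteq> mpoly_vs.span (F ` ?L)"
  proof
    fix f assume "f \<in> W"
    \<comment> \<open>Any bound on the weights will do; unlike a maximum, the sum also makes sense
      for \<open>f = 0\<close>.\<close>
    have "\<forall>m\<in>Poly_Mapping.keys f. \<phi> m < Suc (\<Sum>m\<in>Poly_Mapping.keys f. \<phi> m)"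
      by (simp add: less_Suc_eq_le member_le_sum)
    with \<open>f \<in> W\<close> show "f \<in> mpoly_vs.span (F ` ?L)" by (rule span)
  qed
  then show ?thesis
    using F(1) ind by (intro mpoly_vs.dim_unique[of "F ` ?L"]) (auto simp: card_image)
qed

lemma subspace_polys_on: "mpoly_vs.subspace (polys_on M :: ('v::finite, 'k::field) mpoly set)"
  unfolding mpoly_vs.subspace_def
proof (intro conjI ballI allI)
  fix x y :: "('v, 'k) mpoly" assume "x \<in> polys_on M" "y \<in> polys_on M"
  then show "x + y \<in> polys_on M"
    unfolding polys_on_def using keys_add[of x y] by blast
next
  fix c :: 'k and x :: "('v, 'k) mpoly" assume "x \<in> polys_on M"
  then show "scalar_mult c x \<in> polys_on M"
    unfolding polys_on_def by (auto simp: in_keys_iff)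
qed (simp add: polys_on_def)

text \<open>Any injection of \<open>M\<close> into the naturals may serve as weight, and every
  monomial of \<open>M\<close> leads itself.\<close>

lemma dim_polys_on:
  assumes "finite M"
  shows "mpoly_vs.dim (polys_on M :: ('v::finite, 'k::field) mpoly set) = card M"
proof -
  obtain \<phi> :: "('v \<Rightarrow>\<^sub>0 nat) \<Rightarrow> nat" where inj: "inj_on \<phi> M"
    using finite_imp_inj_to_nat_seg[OF assms] by blast
  have "leads \<phi> (polys_on M :: ('v, 'k) mpoly set) = M"
  proof
    show "M \<subseteq> leads \<phi> (polys_on M :: ('v, 'k) mpoly set)"
    proof
      fix m assume "m \<in> M"
      then have "(Poly_Mapping.single m 1 :: ('v, 'k) mpoly) \<in> polys_on M"
        by (simp add: polys_on_def)
      then show "m \<in> leads \<phi> (polys_on M :: ('v, 'k) mpoly set)"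
        unfolding leads_def leads_at_def by force
    qed
  qed (simp add: leads_subset)
  moreover have "mpoly_vs.dim (polys_on M :: ('v, 'k) mpoly set)
      = card (leads \<phi> (polys_on M :: ('v, 'k) mpoly set))"
    by (rule dim_eq_card_leads[OF subspace_polys_on order_refl assms inj])
  ultimately show ?thesis by simp
qed

lemma hom_polys_eq_polys_on: "hom_polys d = polys_on {m. mon_deg m = d}"
  by (auto simp: hom_polys_def polys_on_def)

text \<open>The upper shadow of \<open>S\<close>: if all of \<open>S\<close> has degree d, these are
  the monomials of degree d + 1 in the ideal generated by \<open>S\<close>.\<close>

definition upset :: "('v::finite \<Rightarrow>\<^sub>0 nat) set \<Rightarrow> ('v \<Rightarrow>\<^sub>0 nat) set" where
  "upset S = {s + Poly_Mapping.single j 1 | s j. s \<in> S}"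

lemma upset_empty [simp]: "upset {} = {}"
  by (simp add: upset_def)

lemma finite_upset: "finite S \<Longrightarrow> finite (upset S)"
proof -
  assume "finite S"
  moreover have "upset S = (\<lambda>(s, j). s + Poly_Mapping.single j 1) ` (S \<times> UNIV)"
    by (auto simp: upset_def)
  ultimately show ?thesis by simp
qed

section \<open>Leading monomials of a homogeneous ideal in two consecutive degrees\<close>

lemma subspace_ideal_hom:
  fixes J :: "('v::finite, 'k::field) mpoly set"
  assumes "homogeneous_ideal J"
  shows "mpoly_vs.subspace (J \<inter> hom_polys d)"
proof -
  have "mpoly_vs.subspace J"
    using assms unfolding homogeneous_ideal_def mpoly_vs.subspace_def ideal.subspace_def
    by (simp add: scalar_mult_def)
  then show ?thesis
    using subspace_polys_on unfolding hom_polys_eq_polys_on by (rule mpoly_vs.subspace_inter)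
qed

text \<open>The set \<open>S\<close> consists of the leading monomials in degree \<open>d\<close>.
  Multiplying a polynomial by a variable multiplies its leading monomial by that variable, so
  \<open>upset S\<close> consists of leading monomials in degree \<open>Suc d\<close>.\<close>

lemma ex_leading_monomials:
  fixes J :: "('v::finite, 'k::field) mpoly set"
  assumes J: "homogeneous_ideal J"
  shows "\<exists>S \<subseteq> {m :: 'v \<Rightarrow>\<^sub>0 nat. mon_deg m = d}. card S = hilbert J d \<and> card (upset S) \<le> hilbert J (Suc d)"
proof -
  \<comment> \<open>The bound \<open>Suc d\<close> lets a single weight serve both degrees.\<close>
  obtain \<phi> :: "('v \<Rightarrow>\<^sub>0 nat) \<Rightarrow> nat"
    where add: "\<And>a b. \<phi> (a + b) = \<phi> a + \<phi> b" and inj: "inj_on \<phi> {m. mon_deg m \<le> Suc d}"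
    using ex_additive_weight by blast
  let ?W = "\<lambda>e. J \<inter> hom_polys e"
  have dim: "hilbert J e = card (leads \<phi> (?W e))" if "e \<le> Suc d" for e
    unfolding hilbert_def
  proof (rule dim_eq_card_leads[where M = "{m. mon_deg m = e}"])
    show "inj_on \<phi> {m. mon_deg m = e}" using inj by (rule inj_on_subset) (use that in auto)
  qed (auto simp: subspace_ideal_hom[OF J] finite_mon_deg_eq, simp add: hom_polys_eq_polys_on)
  have sub: "leads \<phi> (?W e) \<subseteq> {m. mon_deg m = e}" for e
    by (rule leads_subset) (auto simp: hom_polys_eq_polys_on)
  have "upset (leads \<phi> (?W d)) \<subseteq> leads \<phi> (?W (Suc d))"
  proof
    fix x assume "x \<in> upset (leads \<phi> (?W d))"
    then obtain s j f where x: "x = s + Poly_Mapping.single j 1" and f: "f \<in> J" "f \<in> hom_polys d"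
      and lead: "leads_at \<phi> f s" by (auto simp: upset_def leads_def)
    let ?e = "Poly_Mapping.single j (1::nat)"
    let ?g = "var j * f"
    have keys: "Poly_Mapping.keys ?g \<subseteq> (+) ?e ` Poly_Mapping.keys f"
      unfolding var_def by (rule keys_single_times)
    have "?g \<in> J"
      using J f(1) unfolding homogeneous_ideal_def by (simp add: ideal.subspace_scale)
    moreover have "?g \<in> hom_polys (Suc d)"
      using keys f(2) unfolding hom_polys_def by fastforce
    moreover have "leads_at \<phi> ?g x"
    proof -
      have "x \<in> Poly_Mapping.keys ?g"
        using lead lookup_single_times_add[of ?e 1 f s]
        by (simp add: leads_at_def in_keys_iff var_def x add.commute)
      moreover have "\<forall>m'\<in>Poly_Mapping.keys ?g. m' = x \<or> \<phi> m' < \<phi> x"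
        using keys lead unfolding leads_at_def x by (fastforce simp: add add.commute)
      ultimately show ?thesis by (simp add: leads_at_def)
    qed
    ultimately show "x \<in> leads \<phi> (?W (Suc d))" by (auto simp: leads_def)
  qed
  then have "card (upset (leads \<phi> (?W d))) \<le> hilbert J (Suc d)"
    using finite_subset[OF sub finite_mon_deg_eq] by (simp add: dim card_mono)
  then show ?thesis using sub[of d] dim[of d] by (intro exI[of _ "leads \<phi> (?W d)"]) auto
qed

section \<open>Monomial ideals\<close>

definition monom_ideal :: "('v::finite \<Rightarrow>\<^sub>0 nat) set \<Rightarrow> ('v, 'k::field) mpoly set" where
  "monom_ideal S = ideal.span ((\<lambda>s. Poly_Mapping.single s 1) ` S)"

text \<open>Membership becomes a condition on the single monomials of a polynomial, which yields
  homogeneity and turns the Hilbert function into a count.\<close>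

lemma monom_ideal_eq:
  "(monom_ideal S :: ('v::finite, 'k::field) mpoly set) = polys_on {s + t | s t. s \<in> S}"
  (is "_ = polys_on ?M")
proof
  have "ideal.subspace (polys_on ?M :: ('v, 'k) mpoly set)"
    unfolding ideal.subspace_def
  proof (intro conjI ballI allI)
    fix c x :: "('v, 'k) mpoly" assume x: "x \<in> polys_on ?M"
    show "c * x \<in> polys_on ?M"
      unfolding polys_on_def
    proof (clarify)
      fix m assume "m \<in> Poly_Mapping.keys (c * x)"
      then obtain a b where "m = a + b" "b \<in> Poly_Mapping.keys x"
        using keys_mult[of c x] by blast
      moreover then obtain s t where "s \<in> S" "b = s + t" using x by (auto simp: polys_on_def)
      ultimately have "m = s + (a + t)" by (simp add: ac_simps)
      with \<open>s \<in> S\<close> show "\<exists>s t. m = s + t \<and> s \<in> S" by blast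
    qed
  qed (use subspace_polys_on[of ?M] in \<open>auto simp: mpoly_vs.subspace_def\<close>)
  moreover have "(\<lambda>s. Poly_Mapping.single s 1) ` S \<subseteq> (polys_on ?M :: ('v, 'k) mpoly set)"
    by (auto simp: polys_on_def) (metis add.right_neutral)
  ultimately show "monom_ideal S \<subseteq> (polys_on ?M :: ('v, 'k) mpoly set)"
    unfolding monom_ideal_def by (rule ideal.span_minimal[rotated])
next
  show "polys_on ?M \<subseteq> (monom_ideal S :: ('v, 'k) mpoly set)"
  proof
    fix f :: "('v, 'k) mpoly" assume f: "f \<in> polys_on ?M"
    have "f = (\<Sum>m\<in>Poly_Mapping.keys f. Poly_Mapping.single m (Poly_Mapping.lookup f m))"
      by (rule poly_mapping_eqI) (auto simp: lookup_sum lookup_single when_def in_keys_iff)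
    also have "\<dots> \<in> monom_ideal S"
      unfolding monom_ideal_def
    proof (rule ideal.span_sum)
      fix m assume "m \<in> Poly_Mapping.keys f"
      then obtain s t where st: "s \<in> S" "m = s + t" using f by (auto simp: polys_on_def)
      have "Poly_Mapping.single m (Poly_Mapping.lookup f m) =
          Poly_Mapping.single t (Poly_Mapping.lookup f m) * (Poly_Mapping.single s 1 :: ('v, 'k) mpoly)"
        by (simp add: st mult_single add.commute)
      also have "\<dots> \<in> ideal.span ((\<lambda>s. Poly_Mapping.single s 1) ` S)"
        using st by (intro ideal.span_scale ideal.span_base) auto
      finally show "Poly_Mapping.single m (Poly_Mapping.lookup f m)
          \<in> ideal.span ((\<lambda>s. Poly_Mapping.single s 1) ` S)" .
    qed
    finally show "f \<in> monom_ideal S" .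
  qed
qed

lemma homogeneous_monom_ideal: "homogeneous_ideal (monom_ideal S)"
  unfolding homogeneous_ideal_def
proof (intro conjI ballI allI)
  show "ideal.subspace (monom_ideal S)" by (simp add: monom_ideal_def)
  fix f d assume f: "f \<in> monom_ideal S"
  have "Poly_Mapping.keys (hom_component d f) \<subseteq> Poly_Mapping.keys f"
    unfolding hom_component_def
    by (rule order_trans[OF keys_sum]) auto
  with f show "hom_component d f \<in> monom_ideal S"
    unfolding monom_ideal_eq polys_on_def by blast
qed

lemma generated_monom_ideal:
  assumes "S \<subseteq> {m. mon_deg m = d}"
  shows "generated_in_degree d (monom_ideal S)"
  unfolding generated_in_degree_def monom_ideal_def
  using assms by (intro exI conjI refl) (auto simp: hom_polys_def)

section \<open>Hilbert function of a monomial ideal in the degree of its generators and the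
  next\<close>

lemma hilbert_monom_ideal:
  "hilbert (monom_ideal S :: ('v::finite, 'k::field) mpoly set) e
     = card {m \<in> {s + t | s t. s \<in> S}. mon_deg m = e}"
proof -
  have "(monom_ideal S :: ('v, 'k) mpoly set) \<inter> hom_polys e
      = polys_on {m \<in> {s + t | s t. s \<in> S}. mon_deg m = e}"
    unfolding monom_ideal_eq hom_polys_eq_polys_on by (auto simp: polys_on_def)
  then show ?thesis
    unfolding hilbert_def
    using dim_polys_on[OF finite_subset[OF _ finite_mon_deg_eq[of e]],
      of "{m \<in> {s + t | s t. s \<in> S}. mon_deg m = e}"]
    by auto
qed

lemma mon_deg_eq_0: "mon_deg m = 0 \<Longrightarrow> m = 0"
  by (rule poly_mapping_eqI) (metis le_zero_eq lookup_le_mon_deg lookup_zero)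

lemma mon_deg_eq_1:
  assumes "mon_deg m = 1"
  shows "\<exists>j. m = Poly_Mapping.single j 1"
proof -
  have "\<exists>j. Poly_Mapping.lookup m j \<noteq> 0"
    using assms by (metis mon_deg_def sum.neutral zero_neq_one)
  then obtain j where j: "Poly_Mapping.lookup m j \<ge> 1" by (auto simp: Suc_le_eq)
  define r where "r = m - Poly_Mapping.single j 1"
  have m: "m = r + Poly_Mapping.single j 1"
    by (rule poly_mapping_eqI) (use j in \<open>auto simp: r_def lookup_add lookup_minus lookup_single when_def\<close>)
  with assms have "mon_deg r = 0" by simp
  then have "r = 0" by (rule mon_deg_eq_0)
  with m show ?thesis by auto
qed

lemma hilbert_monom_ideal_same:
  assumes S: "S \<subseteq> {m. mon_deg m = d}"
  shows "hilbert (monom_ideal S :: ('v::finite, 'k::field) mpoly set) d = card S"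
proof -
  have "{m \<in> {s + t | s t. s \<in> S}. mon_deg m = d} = S"
  proof (intro subset_antisym subsetI)
    fix m assume "m \<in> {m \<in> {s + t | s t. s \<in> S}. mon_deg m = d}"
    then obtain s t where "m = s + t" "s \<in> S" "mon_deg (s + t) = d" by blast
    moreover have "t = 0" using calculation S by (intro mon_deg_eq_0) auto
    ultimately show "m \<in> S" by simp
  next
    fix m assume "m \<in> S"
    moreover have "m = m + 0" by simp
    ultimately show "m \<in> {m \<in> {s + t | s t. s \<in> S}. mon_deg m = d}" using S by blast
  qed
  then show ?thesis by (simp only: hilbert_monom_ideal)
qed

lemma hilbert_monom_ideal_Suc:
  assumes S: "S \<subseteq> {m. mon_deg m = d}"
  shows "hilbert (monom_ideal S :: ('v::finite, 'k::field) mpoly set) (Suc d) = card (upset S)"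
proof -
  have "{m \<in> {s + t | s t. s \<in> S}. mon_deg m = Suc d} = upset S"
  proof (intro subset_antisym subsetI)
    fix m assume "m \<in> {m \<in> {s + t | s t. s \<in> S}. mon_deg m = Suc d}"
    then obtain s t where m: "m = s + t" "s \<in> S" "mon_deg (s + t) = Suc d" by blast
    then have "mon_deg t = 1" using S by auto
    with m mon_deg_eq_1 show "m \<in> upset S" unfolding upset_def by blast
  next
    fix m assume "m \<in> upset S"
    then obtain s j where "s \<in> S" "m = s + Poly_Mapping.single j 1" by (auto simp: upset_def)
    moreover have "mon_deg m = Suc d" using calculation S by auto
    ultimately show "m \<in> {m \<in> {s + t | s t. s \<in> S}. mon_deg m = Suc d}" by blast
  qed
  then show ?thesis by (simp only: hilbert_monom_ideal)
qed

text \<open>One direction compares with the monomial ideals of the sets \<open>T\<close>. For the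
  other, \<open>ex_leading_monomials\<close> replaces a competing ideal by a set of monomials with
  the same count in degree \<open>d\<close> and no more multiples in degree
  \<open>Suc d\<close>.\<close>

lemma gotzmann_monom_ideal_iff:
  fixes S :: "('v::finite \<Rightarrow>\<^sub>0 nat) set"
  assumes S: "S \<subseteq> {m. mon_deg m = d}"
  shows "gotzmann d (monom_ideal S :: ('v, 'k::field) mpoly set) \<longleftrightarrow>
    (\<forall>T \<subseteq> {m :: 'v \<Rightarrow>\<^sub>0 nat. mon_deg m = d}. card T = card S \<longrightarrow> card (upset S) \<le> card (upset T))"
proof
  assume g: "gotzmann d (monom_ideal S :: ('v, 'k) mpoly set)"
  show "\<forall>T \<subseteq> {m :: 'v \<Rightarrow>\<^sub>0 nat. mon_deg m = d}. card T = card S \<longrightarrow> card (upset S) \<le> card (upset T)"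
  proof (intro allI impI)
    fix T :: "('v \<Rightarrow>\<^sub>0 nat) set"
    assume T: "T \<subseteq> {m. mon_deg m = d}" "card T = card S"
    have "hilbert (monom_ideal S :: ('v, 'k) mpoly set) (Suc d)
        \<le> hilbert (monom_ideal T :: ('v, 'k) mpoly set) (Suc d)"
      using g homogeneous_monom_ideal T
        hilbert_monom_ideal_same[OF S, where 'k = 'k] hilbert_monom_ideal_same[OF T(1), where 'k = 'k]
      unfolding gotzmann_def by metis
    then show "card (upset S) \<le> card (upset T)"
      by (simp add: hilbert_monom_ideal_Suc S T(1))
  qed
next
  assume min: "\<forall>T \<subseteq> {m :: 'v \<Rightarrow>\<^sub>0 nat. mon_deg m = d}.
    card T = card S \<longrightarrow> card (upset S) \<le> card (upset T)"
  show "gotzmann d (monom_ideal S :: ('v, 'k) mpoly set)"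
    unfolding gotzmann_def
  proof (intro conjI allI impI)
    fix J :: "('v, 'k) mpoly set"
    assume J: "homogeneous_ideal J \<and> hilbert (monom_ideal S :: ('v, 'k) mpoly set) d = hilbert J d"
    then obtain T :: "('v \<Rightarrow>\<^sub>0 nat) set" where "T \<subseteq> {m. mon_deg m = d}" "card T = hilbert J d"
      "card (upset T) \<le> hilbert J (Suc d)"
      using ex_leading_monomials[of J d] by blast
    moreover from this(1,2) have "card (upset S) \<le> card (upset T)"
      using min J hilbert_monom_ideal_same[OF S, where 'k = 'k] by simp
    ultimately show "hilbert (monom_ideal S :: ('v, 'k) mpoly set) (Suc d) \<le> hilbert J (Suc d)"
      unfolding hilbert_monom_ideal_Suc[OF S] by linarith
  qed (simp_all add: homogeneous_monom_ideal generated_monom_ideal[OF S])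
qed

section \<open>Growth of sets of monomials\<close>

lemma inj_single_1: "inj (\<lambda>j. Poly_Mapping.single j (1::nat))"
  by (rule injI) (metis keys_single singleton_inject zero_neq_one)

lemma card_upset_insert:
  fixes S :: "('v::finite \<Rightarrow>\<^sub>0 nat) set"
  assumes "finite S"
  shows "card (upset (insert s S))
    = card (upset S) + card {j. s + Poly_Mapping.single j 1 \<notin> upset S}"
proof -
  let ?B = "{j. s + Poly_Mapping.single j 1 \<notin> upset S}"
  let ?f = "\<lambda>j. s + Poly_Mapping.single j 1"
  have "upset (insert s S) = upset S \<union> ?f ` ?B"
    by (auto simp: upset_def)
  also have "card \<dots> = card (upset S) + card (?f ` ?B)"
    using assms by (intro card_Un_disjoint) (auto simp: finite_upset)
  also have "card (?f ` ?B) = card ?B"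
    using inj_single_1 by (intro card_image) (auto simp: inj_on_def)
  finally show ?thesis .
qed

text \<open>Two distinct monomials \<open>s\<close>, \<open>t\<close> of the same degree have at most one common upper neighbour,
  their least common multiple, so each \<open>t \<in> S\<close> excludes at most one of the products \<open>x\<^sub>j s\<close>.\<close>

lemma card_upset_insert_ge:
  fixes S :: "('v::finite \<Rightarrow>\<^sub>0 nat) set"
  assumes "finite S" "s \<notin> S"
  shows "card (upset S) + (CARD('v) - card S) \<le> card (upset (insert s S))"
proof -
  let ?e = "\<lambda>j. Poly_Mapping.single j (1::nat)"
  let ?B = "{j. s + ?e j \<in> upset S}"
  have "\<forall>j\<in>?B. \<exists>t k. t \<in> S \<and> s + ?e j = t + ?e k" by (auto simp: upset_def)
  then obtain t k where tk: "\<And>j. j \<in> ?B \<Longrightarrow> t j \<in> S" "\<And>j. j \<in> ?B \<Longrightarrow> s + ?e j = t j + ?e (k j)"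
    by metis
  have "inj_on t ?B"
  proof (rule inj_onI, rule ccontr)
    fix i j assume ij: "i \<in> ?B" "j \<in> ?B" "t i = t j" "i \<noteq> j"
    \<comment> \<open>If \<open>k i = i\<close>, cancelling would give \<open>s = t i\<close>, which
      lies in \<open>S\<close>. So the exponent of \<open>i\<close> in \<open>t i\<close> is one
      more than in \<open>s\<close>, whereas the equation for \<open>j\<close> allows at most the
      exponent in \<open>s\<close>.\<close>
    have "k i \<noteq> i" using tk[OF ij(1)] assms(2) by auto
    have 1: "Poly_Mapping.lookup (s + ?e i) i = Poly_Mapping.lookup (t i + ?e (k i)) i"
      and 2: "Poly_Mapping.lookup (s + ?e j) i = Poly_Mapping.lookup (t i + ?e (k j)) i"
      using tk(2)[OF ij(1)] tk(2)[OF ij(2)] ij(3) by simp_all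
    show False
      using 1 2 \<open>k i \<noteq> i\<close> ij(4) by (simp add: lookup_add lookup_single when_def split: if_splits)
  qed
  moreover have "t ` ?B \<subseteq> S" using tk(1) by auto
  ultimately have "card ?B \<le> card S" using assms(1) by (rule card_inj_on_le)
  moreover have "card {j. s + ?e j \<notin> upset S} = CARD('v) - card ?B"
    using card_Diff_subset[of ?B UNIV] by (simp add: Collect_neg_eq Compl_eq_Diff_UNIV)
  ultimately show ?thesis using card_upset_insert[OF assms(1), of s] by simp
qed

text \<open>The elements of \<open>T - S\<close> are added one at a time. Truncated subtraction
  makes the summands with \<open>i\<close> beyond the number of variables zero, so large sets are
  covered too.\<close>

lemma card_upset_growth:
  fixes S T :: "('v::finite \<Rightarrow>\<^sub>0 nat) set"
  assumes "finite T" "S \<subseteq> T"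
  shows "card (upset S) + (\<Sum>i = card S..<card T. CARD('v) - i) \<le> card (upset T)"
proof -
  have "finite S" using assms finite_subset by blast
  have "card (upset S) + (\<Sum>i = card S..<card (S \<union> R). CARD('v) - i) \<le> card (upset (S \<union> R))"
    if "finite R" "S \<inter> R = {}" for R
    using that
  proof (induction R rule: finite_induct)
    case (insert x R)
    have "card S \<le> card (S \<union> R)" using \<open>finite S\<close> insert by (intro card_mono) auto
    then show ?case
      using insert \<open>finite S\<close> card_upset_insert_ge[of "S \<union> R" x] by simp
  qed simp
  from this[of "T - S"] show ?thesis using assms by (simp add: Un_absorb1)
qed

lemma card_upset_ge:
  fixes S :: "('v::finite \<Rightarrow>\<^sub>0 nat) set"
  assumes "finite S"
  shows "(\<Sum>i<card S. CARD('v) - i) \<le> card (upset S)"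
  using card_upset_growth[OF assms empty_subsetI] by (simp add: lessThan_atLeast0)

text \<open>Shows that \<open>card_upset_ge\<close> is sharp. When \<open>a\<close> is added, its
  product with a variable \<open>j\<close> already in \<open>A\<close> is also the product of the
  monomial of \<open>j\<close> with the variable \<open>a\<close>, so it is not new. Since
  \<open>A\<close> may contain \<open>v\<close>, all multiples of the variable \<open>v\<close> of
  degree two are covered, including its square.\<close>

lemma card_upset_multiples_le:
  fixes A :: "'v::finite set"
  shows "card (upset ((\<lambda>a. Poly_Mapping.single v 1 + Poly_Mapping.single a 1) ` A))
    \<le> (\<Sum>i<card A. CARD('v) - i)"
  using finite[of A]
proof (induction A rule: finite_induct)
  case (insert a A)
  let ?e = "\<lambda>j. Poly_Mapping.single j (1::nat)"
  let ?S = "(\<lambda>a. ?e v + ?e a) ` A"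
  have "{j. (?e v + ?e a) + ?e j \<notin> upset ?S} \<subseteq> UNIV - A"
  proof
    fix j assume j: "j \<in> {j. (?e v + ?e a) + ?e j \<notin> upset ?S}"
    have "j \<notin> A"
    proof
      assume "j \<in> A"
      then have "(?e v + ?e j) + ?e a \<in> upset ?S" unfolding upset_def by blast
      with j show False by (simp add: add_ac)
    qed
    then show "j \<in> UNIV - A" by simp
  qed
  then have "card {j. (?e v + ?e a) + ?e j \<notin> upset ?S} \<le> CARD('v) - card A"
    using card_mono[of "UNIV - A"] by (simp add: card_Diff_subset)
  then show ?case using insert card_upset_insert[of ?S "?e v + ?e a"] by simp
qed simp

section \<open>Edge monomials\<close>

definition edge_monom :: "'v::finite set \<Rightarrow> 'v \<Rightarrow>\<^sub>0 nat" where
  "edge_monom e = (\<Sum>i\<in>e. Poly_Mapping.single i 1)"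

lemma lookup_edge_monom [simp]: "Poly_Mapping.lookup (edge_monom e) i = (if i \<in> e then 1 else 0)"
  by (simp add: edge_monom_def lookup_sum lookup_single when_def)

lemma keys_edge_monom [simp]: "Poly_Mapping.keys (edge_monom e) = e"
  by (auto simp: in_keys_iff split: if_splits)

lemma inj_edge_monom: "inj_on edge_monom E"
  by (rule inj_onI) (metis keys_edge_monom)

lemma mon_deg_edge_monom [simp]: "mon_deg (edge_monom e) = card e"
  by (simp add: mon_deg_def sum.If_cases)

lemma edge_monom_pair:
  "i \<noteq> j \<Longrightarrow> edge_monom {i, j} = Poly_Mapping.single i 1 + Poly_Mapping.single j 1"
  by (simp add: edge_monom_def)

lemma edge_monoms_deg: "simple_graph E \<Longrightarrow> edge_monom ` E \<subseteq> {m. mon_deg m = 2}"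
  by (auto simp: simple_graph_def)

lemma edge_ideal_eq_monom_ideal:
  assumes "simple_graph E"
  shows "(edge_ideal E :: ('v::finite, 'k::field) mpoly set) = monom_ideal (edge_monom ` E)"
proof -
  have eq: "var i * var j = (Poly_Mapping.single (edge_monom {i, j}) 1 :: ('v, 'k) mpoly)"
    if "{i, j} \<in> E" for i j
  proof -
    have "i \<noteq> j" using assms that by (auto simp: simple_graph_def)
    then show ?thesis by (simp add: var_def edge_monom_pair mult_single)
  qed
  have "{var i * var j | i j. {i, j} \<in> E}
      = (\<lambda>s. Poly_Mapping.single s 1 :: ('v, 'k) mpoly) ` edge_monom ` E"
  proof (intro subset_antisym subsetI)
    fix x :: "('v, 'k) mpoly"
    assume "x \<in> (\<lambda>s. Poly_Mapping.single s 1) ` edge_monom ` E"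
    then obtain e where e: "e \<in> E" "x = Poly_Mapping.single (edge_monom e) 1" by blast
    then obtain i j where "e = {i, j}" using assms by (metis simple_graph_def card_2_iff)
    with e eq[of i j] have "x = var i * var j" "{i, j} \<in> E" by simp_all
    then show "x \<in> {var i * var j | i j. {i, j} \<in> E}" by blast
  qed (use eq in auto)
  then show ?thesis by (simp add: edge_ideal_def monom_ideal_def)
qed

text \<open>The upper shadow of the edge monomials in terms of supports: a squarefree monomial
  divides \<open>m\<close> exactly if its support lies in that of \<open>m\<close>. This form is
  convenient under permutations of the variables.\<close>

definition edge_upset :: "'v::finite set set \<Rightarrow> ('v \<Rightarrow>\<^sub>0 nat) set" where
  "edge_upset E = {m. mon_deg m = 3 \<and> (\<exists>e\<in>E. e \<subseteq> Poly_Mapping.keys m)}"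

lemma upset_edge_monoms:
  assumes "simple_graph E"
  shows "upset (edge_monom ` E) = edge_upset E"
proof (intro subset_antisym subsetI)
  fix m assume "m \<in> upset (edge_monom ` E)"
  then obtain e j where e: "e \<in> E" "m = edge_monom e + Poly_Mapping.single j 1"
    by (auto simp: upset_def)
  then have "e \<subseteq> Poly_Mapping.keys m" by (auto simp: in_keys_iff lookup_add)
  moreover have "mon_deg m = 3" using e assms by (simp add: simple_graph_def)
  ultimately show "m \<in> edge_upset E" using e by (auto simp: edge_upset_def)
next
  fix m assume "m \<in> edge_upset E"
  then obtain e where e: "e \<in> E" "e \<subseteq> Poly_Mapping.keys m" "mon_deg m = 3"
    by (auto simp: edge_upset_def)
  define r where "r = m - edge_monom e"
  have m: "m = edge_monom e + r"
  proof (rule poly_mapping_eqI)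
    fix k
    show "Poly_Mapping.lookup m k = Poly_Mapping.lookup (edge_monom e + r) k"
      using e(2) by (cases "k \<in> e") (auto simp: r_def lookup_add lookup_minus in_keys_iff Suc_le_eq)
  qed
  with e assms have "mon_deg r = 1" by (simp add: simple_graph_def)
  with mon_deg_eq_1 e(1) m show "m \<in> upset (edge_monom ` E)" unfolding upset_def by blast
qed

lemma finite_edge_upset: "finite (edge_upset E)"
  by (rule finite_subset[OF _ finite_mon_deg_eq[of 3]]) (auto simp: edge_upset_def)

section \<open>Few edges\<close>

lemma is_star_iff: "is_star E \<longleftrightarrow> (\<exists>v. \<forall>e\<in>E. v \<in> e)"
proof -
  have "vertex_degree E v = card E \<longleftrightarrow> (\<forall>e\<in>E. v \<in> e)" for v
  proof
    assume "vertex_degree E v = card E"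
    then have "{e \<in> E. v \<in> e} = E"
      unfolding vertex_degree_def by (intro card_subset_eq) auto
    then show "\<forall>e\<in>E. v \<in> e" by auto
  next
    assume "\<forall>e\<in>E. v \<in> e"
    then have "{e \<in> E. v \<in> e} = E" by auto
    then show "vertex_degree E v = card E" by (simp add: vertex_degree_def)
  qed
  then show ?thesis by (simp add: is_star_def)
qed

lemma star_edges_eq:
  assumes "simple_graph E" "\<forall>e\<in>E. v \<in> e"
  shows "E = (\<lambda>a. {v, a}) ` {a. {v, a} \<in> E}"
proof -
  have "\<exists>a. e = {v, a}" if "e \<in> E" for e
    using assms that by (metis simple_graph_def card_2_iff insertE insert_commute singletonD)
  then show ?thesis by blast
qed

lemma card_upset_star:
  fixes E :: "'v::finite set set"
  assumes "simple_graph E" "is_star E"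
  shows "card (upset (edge_monom ` E)) \<le> (\<Sum>i<card E. CARD('v) - i)"
proof -
  obtain v where v: "\<forall>e\<in>E. v \<in> e" using assms(2) is_star_iff by blast
  define A where "A = {a. {v, a} \<in> E}"
  have E: "E = (\<lambda>a. {v, a}) ` A" unfolding A_def by (rule star_edges_eq[OF assms(1) v])
  have "v \<noteq> a" if "a \<in> A" for a
    using that assms(1) by (auto simp: A_def simple_graph_def)
  then have "edge_monom ` E = (\<lambda>a. Poly_Mapping.single v 1 + Poly_Mapping.single a 1) ` A"
    unfolding E image_image by (intro image_cong) (auto simp: edge_monom_pair)
  moreover have "card E = card A"
    unfolding E by (intro card_image) (auto simp: inj_on_def doubleton_eq_iff)
  ultimately show ?thesis using card_upset_multiples_le[of v A] by simp
qed

text \<open>If edges meet pairwise and have no common vertex, then for an edge ab an edge avoiding a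
  has the form bc, and an edge avoiding b must then be ac.\<close>

lemma not_star_cases:
  assumes E: "simple_graph E" "\<not> is_star E"
  obtains (disjoint) e f where "e \<in> E" "f \<in> E" "e \<inter> f = {}"
    | (triangle) a b c where "{a, b} \<in> E" "{b, c} \<in> E" "{a, c} \<in> E" "a \<noteq> b" "b \<noteq> c" "a \<noteq> c"
proof (cases "\<exists>e\<in>E. \<exists>f\<in>E. e \<inter> f = {}")
  case True
  then show ?thesis using disjoint by blast
next
  case False
  then have meet: "e \<inter> f \<noteq> {}" if "e \<in> E" "f \<in> E" for e f using that by blast
  have avoid: "\<exists>e\<in>E. v \<notin> e" for v using E(2) is_star_iff by blast
  have pair: "\<exists>x y. e = {x, y} \<and> x \<noteq> y" if "e \<in> E" for e
    using that E(1) by (auto simp: simple_graph_def card_2_iff)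
  from avoid pair obtain a b where ab: "{a, b} \<in> E" "a \<noteq> b" by metis
  obtain f where f: "f \<in> E" "a \<notin> f" using avoid by blast
  have "b \<in> f" using meet[OF ab(1) f(1)] f(2) by auto
  with pair[OF f(1)] f(2) obtain c where c: "f = {b, c}" "b \<noteq> c" "a \<noteq> c" by auto
  obtain g where g: "g \<in> E" "b \<notin> g" using avoid by blast
  have "a \<in> g" "c \<in> g" using meet[OF ab(1) g(1)] meet[OF f(1) g(1)] c(1) g(2) by auto
  with pair[OF g(1)] c(3) have "g = {a, c}" by auto
  with g(1) f(1) c ab show ?thesis by (intro triangle[of a b c]) simp_all
qed

text \<open>Strictness for some subset \<open>S\<close> of the edge monomials suffices, since
  \<open>card_upset_growth\<close> carries the excess over to all of \<open>E\<close>.\<close>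

lemma card_upset_not_star:
  fixes E :: "'v::finite set set"
  assumes E: "simple_graph E" "\<not> is_star E"
  shows "(\<Sum>i<card E. CARD('v) - i) < card (upset (edge_monom ` E))"
proof -
  have "\<exists>S\<subseteq>edge_monom ` E. (\<Sum>i<card S. CARD('v) - i) < card (upset S)"
    using E
  proof (cases rule: not_star_cases)
    case (disjoint e f)
    obtain a b where ab: "e = {a, b}" "a \<noteq> b"
      using disjoint E(1) by (auto simp: simple_graph_def card_2_iff)
    let ?S = "{edge_monom f, edge_monom e}"
    have "edge_monom f + Poly_Mapping.single j 1 \<noteq> edge_monom e + Poly_Mapping.single k 1" for j k
    proof
      assume eq: "edge_monom f + Poly_Mapping.single j 1 = edge_monom e + Poly_Mapping.single k 1"
      \<comment> \<open>The single factor \<open>j\<close> on the left cannot supply both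
        \<open>a\<close> and \<open>b\<close>. Hence the two edges have no common multiple of degree
        three.\<close>
      have "a \<notin> f" "b \<notin> f" using disjoint ab by auto
      with arg_cong[OF eq, of "\<lambda>m. Poly_Mapping.lookup m a"]
        arg_cong[OF eq, of "\<lambda>m. Poly_Mapping.lookup m b"] ab
      show False by (simp add: lookup_add lookup_single when_def split: if_splits)
    qed
    then have "card {j. edge_monom f + Poly_Mapping.single j 1 \<notin> upset {edge_monom e}} = CARD('v)"
      by (simp add: upset_def)
    moreover have "card (upset {edge_monom e}) = CARD('v)"
      using card_upset_insert[of "{}" "edge_monom e"] by simp
    ultimately have "card (upset ?S) = CARD('v) + CARD('v)"
      using card_upset_insert[of "{edge_monom e}" "edge_monom f"] by simp
    moreover have "edge_monom f \<noteq> edge_monom e"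
      using disjoint ab inj_edge_monom[of UNIV] by (auto dest: injD)
    then have "card ?S = 2" by simp
    moreover have "CARD('v) > 0" by simp
    ultimately show ?thesis
      using disjoint by (intro exI[of _ ?S]) (auto simp: numeral_2_eq_2)
  next
    case (triangle a b c)
    let ?T = "{edge_monom {b, c}, edge_monom {a, b}}"
    let ?S = "insert (edge_monom {a, c}) ?T"
    have inj: "edge_monom e = edge_monom f \<longleftrightarrow> e = f" for e f :: "'v set"
      using keys_edge_monom by metis
    have T: "card ?T = 2" and S: "card ?S = 3"
      using triangle by (auto simp: inj doubleton_eq_iff)
    have n: "CARD('v) \<ge> 3"
      using card_mono[of UNIV "{a, b, c}"] triangle by simp
    \<comment> \<open>Both edges in \<open>?T\<close> contain \<open>b\<close>, so a multiple of the
      third edge that avoids \<open>b\<close> is new. This gives one more than the general bound for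
      a third monomial.\<close>
    have "UNIV - {b} \<subseteq> {j. edge_monom {a, c} + Poly_Mapping.single j 1 \<notin> upset ?T}"
    proof
      fix j assume "j \<in> UNIV - {b}"
      then have "Poly_Mapping.lookup (edge_monom {a, c} + Poly_Mapping.single j 1) b = 0"
        using triangle by (simp add: lookup_add lookup_single when_def)
      moreover have "Poly_Mapping.lookup m b \<noteq> 0" if "m \<in> upset ?T" for m
        using that by (auto simp: upset_def lookup_add)
      ultimately have "edge_monom {a, c} + Poly_Mapping.single j 1 \<notin> upset ?T" by metis
      then show "j \<in> {j. edge_monom {a, c} + Poly_Mapping.single j 1 \<notin> upset ?T}" by simp
    qed
    then have "CARD('v) - 1 \<le> card {j. edge_monom {a, c} + Poly_Mapping.single j 1 \<notin> upset ?T}"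
      using card_mono[of "{j. edge_monom {a, c} + Poly_Mapping.single j 1 \<notin> upset ?T}" "UNIV - {b}"]
      by (simp add: card_Diff_subset)
    moreover have "(\<Sum>i<2. CARD('v) - i) \<le> card (upset ?T)"
      using card_upset_ge[of ?T] T by simp
    ultimately have "(\<Sum>i<3. CARD('v) - i) < card (upset ?S)"
      using card_upset_insert[of ?T "edge_monom {a, c}"] n
      by (simp add: numeral_2_eq_2 numeral_3_eq_3)
    with S triangle show ?thesis by (intro exI[of _ ?S]) auto
  qed
  then obtain S where S: "S \<subseteq> edge_monom ` E" "(\<Sum>i<card S. CARD('v) - i) < card (upset S)"
    by blast
  have card: "card (edge_monom ` E) = card E" by (rule card_image[OF inj_edge_monom])
  have "card S \<le> card E" using card_mono[OF _ S(1)] card by simp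
  then have "(\<Sum>i<card E. CARD('v) - i)
      = (\<Sum>i<card S. CARD('v) - i) + (\<Sum>i = card S..<card E. CARD('v) - i)"
    unfolding lessThan_atLeast0 by (intro sum.atLeastLessThan_concat[symmetric]) auto
  with S card_upset_growth[OF _ S(1)] card show ?thesis by simp
qed

section \<open>Many edges\<close>

text \<open>This is compression from \<open>i\<close> towards \<open>v\<close>: an edge containing
  \<open>i\<close> but not \<open>v\<close> has \<open>i\<close> replaced by \<open>v\<close>,
  unless the result is already an edge. As \<open>{u, i}\<close> becomes \<open>{u, v}\<close>, the
  degree of \<open>v\<close> grows.\<close>

lemma ex_shift:
  fixes E :: "'v::finite set set"
  assumes E: "simple_graph E" and uiv: "i \<noteq> v" "u \<noteq> v" "{u, i} \<in> E" "{u, v} \<notin> E"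
  shows "\<exists>E'. simple_graph E' \<and> card E' = card E \<and> card (edge_upset E') \<le> card (edge_upset E)
    \<and> card {e \<in> E. v \<in> e} < card {e \<in> E'. v \<in> e}"
proof -
  define \<pi> where "\<pi> = transpose i v"
  \<comment> \<open>The last condition keeps \<sigma> injective: a moved edge never lands on an edge
    that stays.\<close>
  define moved where "moved e \<longleftrightarrow> i \<in> e \<and> v \<notin> e \<and> \<pi> ` e \<notin> E" for e
  define \<sigma> where "\<sigma> e = (if moved e then \<pi> ` e else e)" for e
  have \<pi>\<pi>: "\<pi> (\<pi> x) = x" for x by (simp add: \<pi>_def)
  have \<pi>\<pi>': "\<pi> ` \<pi> ` X = X" for X by (simp add: image_image \<pi>\<pi>)
  have bij: "bij \<pi>" by (simp add: \<pi>_def)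
  have \<pi>_iv: "\<pi> i = v" "\<pi> v = i" by (simp_all add: \<pi>_def)
  have \<pi>_id: "\<pi> ` X = X" if "i \<notin> X" "v \<notin> X" for X
    using that by (force simp: \<pi>_def transpose_def)
  have "inj_on \<sigma> E"
    by (rule inj_onI) (metis \<sigma>_def \<pi>\<pi>' moved_def)
  then have "card (\<sigma> ` E) = card E" by (rule card_image)
  moreover have "simple_graph (\<sigma> ` E)"
    using E card_image[OF inj_on_subset[OF bij_is_inj[OF bij] subset_UNIV]]
    by (auto simp: simple_graph_def \<sigma>_def)
  moreover have "card {e \<in> E. v \<in> e} < card {e \<in> \<sigma> ` E. v \<in> e}"
  proof (rule psubset_card_mono)
    have "u \<noteq> i" using E uiv(3) by (auto simp: simple_graph_def)
    then have "\<pi> ` {u, i} = {u, v}" using uiv by (simp add: \<pi>_def)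
    then have "\<sigma> {u, i} = {u, v}" using uiv by (auto simp: \<sigma>_def moved_def)
    then have "{u, v} \<in> {e \<in> \<sigma> ` E. v \<in> e}" using uiv(3) by (metis (mono_tags) image_eqI insert_iff mem_Collect_eq)
    moreover have "\<sigma> e = e" if "v \<in> e" for e using that by (simp add: \<sigma>_def moved_def)
    then have "{e \<in> E. v \<in> e} \<subseteq> {e \<in> \<sigma> ` E. v \<in> e}" by (auto intro: rev_image_eqI)
    ultimately show "{e \<in> E. v \<in> e} \<subset> {e \<in> \<sigma> ` E. v \<in> e}" using uiv(4) by blast
  qed simp
  moreover have "card (edge_upset (\<sigma> ` E)) \<le> card (edge_upset E)"
  proof -
    \<comment> \<open>A cubic gained by the shift is charged to its image under exchanging \<open>x\<^sub>i\<close> and \<open>x\<^sub>v\<close>,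
      which the shift loses.\<close>
    define swap :: "('v \<Rightarrow>\<^sub>0 nat) \<Rightarrow> 'v \<Rightarrow>\<^sub>0 nat" where "swap = Poly_Mapping.map_key \<pi>"
    have lookup_swap: "Poly_Mapping.lookup (swap m) k = Poly_Mapping.lookup m (\<pi> k)" for m k
      using bij unfolding swap_def by (simp add: map_key.rep_eq bij_is_inj)
    have swap_swap: "swap (swap m) = m" for m
      by (rule poly_mapping_eqI) (simp add: lookup_swap \<pi>\<pi>)
    have keys_swap: "Poly_Mapping.keys (swap m) = \<pi> ` Poly_Mapping.keys m" for m
    proof (intro set_eqI)
      fix k
      show "k \<in> Poly_Mapping.keys (swap m) \<longleftrightarrow> k \<in> \<pi> ` Poly_Mapping.keys m"
        unfolding in_keys_iff lookup_swap image_iff by (metis \<pi>\<pi> in_keys_iff)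
    qed
    have deg_swap: "mon_deg (swap m) = mon_deg m" for m
      unfolding mon_deg_def lookup_swap by (rule sum.reindex_bij_betw[OF bij])
    have swap: "swap m \<in> edge_upset E" "swap m \<notin> edge_upset (\<sigma> ` E)"
      if m: "m \<in> edge_upset (\<sigma> ` E)" "m \<notin> edge_upset E" for m
    proof -
      let ?K = "Poly_Mapping.keys m"
      have m3: "mon_deg m = 3" using m by (simp add: edge_upset_def)
      have notsub: "\<not> f \<subseteq> ?K" if "f \<in> E" for f
        using that m(2) m3 by (auto simp: edge_upset_def)
      obtain e where e: "e \<in> E" "\<sigma> e \<subseteq> ?K" using m by (auto simp: edge_upset_def)
      have "moved e" using e notsub by (auto simp: \<sigma>_def split: if_splits)
      with e have sub: "\<pi> ` e \<subseteq> ?K" and "i \<in> e" "v \<notin> e"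
        by (simp_all add: \<sigma>_def moved_def)
      have "e \<subseteq> \<pi> ` ?K" using image_mono[OF sub, of \<pi>] by (simp only: \<pi>\<pi>')
      then show "swap m \<in> edge_upset E"
        using e(1) m3 unfolding edge_upset_def mem_Collect_eq keys_swap deg_swap by blast
      have "i \<notin> ?K"
      proof
        assume "i \<in> ?K"
        have "x \<in> ?K" if "x \<in> e" for x
        proof (cases "x = i")
          case False
          then have "\<pi> x = x" using that \<open>v \<notin> e\<close> by (auto simp: \<pi>_def transpose_def)
          then show ?thesis using sub that by (metis image_eqI subsetD)
        qed (use \<open>i \<in> ?K\<close> in simp)
        then show False using notsub[OF e(1)] by blast
      qed
      show "swap m \<notin> edge_upset (\<sigma> ` E)"
      proof
        assume "swap m \<in> edge_upset (\<sigma> ` E)"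
        then obtain f where f: "f \<in> E" "\<sigma> f \<subseteq> \<pi> ` ?K"
          unfolding edge_upset_def mem_Collect_eq keys_swap by blast
        have v: "v \<notin> \<sigma> f" using f(2) \<open>i \<notin> ?K\<close> \<pi>\<pi> \<pi>_iv by (metis imageE subsetD)
        have "\<not> moved f"
        proof
          assume "moved f"
          then have "v \<in> \<sigma> f" using \<pi>_iv by (auto simp: \<sigma>_def moved_def intro: rev_image_eqI)
          with v show False by simp
        qed
        then have "\<sigma> f = f" by (simp add: \<sigma>_def)
        \<comment> \<open>As \<open>f\<close> avoids \<open>v\<close> and was not moved, either it
          also avoids \<open>i\<close> and is fixed by \<pi>, or its image was already an
          edge.\<close>
        have "\<pi> ` f \<in> E"
          using \<open>\<not> moved f\<close> f(1) v \<pi>_id[of f] unfolding \<open>\<sigma> f = f\<close> moved_def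
          by (cases "i \<in> f") auto
        moreover have "\<pi> ` f \<subseteq> ?K"
          using image_mono[OF f(2), of \<pi>] unfolding \<open>\<sigma> f = f\<close> \<pi>\<pi>' .
        ultimately show False using notsub by blast
      qed
    qed
    define g where "g m = (if m \<in> edge_upset E then m else swap m)" for m
    show ?thesis
    proof (rule card_inj_on_le)
      show "inj_on g (edge_upset (\<sigma> ` E))"
        by (rule inj_onI) (metis g_def swap swap_swap)
      show "g ` edge_upset (\<sigma> ` E) \<subseteq> edge_upset E"
        using swap by (auto simp: g_def)
    qed (rule finite_edge_upset)
  qed
  ultimately show ?thesis by blast
qed

text \<open>Among the graphs with as many edges and no larger shadow, one with the greatest degree
  at \<open>v\<close> is stable, because a violation would allow a further shift.\<close>

lemma ex_stable_graph:
  fixes E :: "'v::finite set set" and v :: 'v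
  assumes "simple_graph E"
  shows "\<exists>E'. simple_graph E' \<and> card E' = card E \<and> card (edge_upset E') \<le> card (edge_upset E)
    \<and> (\<forall>i u. i \<noteq> v \<longrightarrow> u \<noteq> v \<longrightarrow> {u, i} \<in> E' \<longrightarrow> {u, v} \<in> E')"
proof -
  define P where "P X \<longleftrightarrow> simple_graph X \<and> card X = card E \<and> card (edge_upset X) \<le> card (edge_upset E)"
    for X :: "'v set set"
  define deg where "deg X = card {e \<in> X. v \<in> e}" for X
  have "P E" using assms by (simp add: P_def)
  moreover have "\<forall>X. P X \<longrightarrow> deg X < Suc (card (UNIV :: 'v set set))"
    unfolding deg_def less_Suc_eq_le by (intro allI impI card_mono) auto
  ultimately obtain E' where E': "P E'" "\<And>X. P X \<Longrightarrow> deg X \<le> deg E'"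
    using ex_has_greatest_nat[of P E deg] by blast
  have "{u, v} \<in> E'" if "i \<noteq> v" "u \<noteq> v" "{u, i} \<in> E'" for i u
  proof (rule ccontr)
    assume notin: "{u, v} \<notin> E'"
    have "simple_graph E'" using E'(1) by (simp add: P_def)
    from ex_shift[OF this that notin] obtain X where "simple_graph X" "card X = card E'"
      "card (edge_upset X) \<le> card (edge_upset E')" "deg E' < deg X"
      unfolding deg_def by blast
    moreover from this have "P X" using E'(1) by (simp add: P_def)
    ultimately show False using E'(2)[of X] by simp
  qed
  then show ?thesis using E'(1) unfolding P_def by blast
qed

lemma ex_smaller_upset:
  fixes E :: "'v::finite set set"
  assumes E: "simple_graph E" and many: "CARD('v) \<le> card E"
  shows "\<exists>T\<subseteq>{m :: 'v \<Rightarrow>\<^sub>0 nat. mon_deg m = 2}.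
    card T = card E \<and> card (upset T) < card (upset (edge_monom ` E))"
proof -
  fix v :: 'v
  obtain F where F: "simple_graph F" "card F = card E" "card (edge_upset F) \<le> card (edge_upset E)"
    and stable: "\<And>i u. i \<noteq> v \<Longrightarrow> u \<noteq> v \<Longrightarrow> {u, i} \<in> F \<Longrightarrow> {u, v} \<in> F"
    using ex_stable_graph[OF E, of v] by blast
  \<comment> \<open>Only n - 1 edges can contain \<open>v\<close>, which is where the hypothesis
    \<open>many\<close> enters.\<close>
  have "\<exists>e\<in>F. v \<notin> e"
  proof (rule ccontr)
    assume "\<not> (\<exists>e\<in>F. v \<notin> e)"
    then have "F = (\<lambda>a. {v, a}) ` {a. {v, a} \<in> F}" using star_edges_eq[OF F(1)] by blast
    then have "card F \<le> card {a. {v, a} \<in> F}" using card_image_le by (metis finite)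
    also have "{a. {v, a} \<in> F} \<subseteq> UNIV - {v}"
      using F(1) by (auto simp: simple_graph_def)
    then have "card {a. {v, a} \<in> F} \<le> card (UNIV - {v})" by (intro card_mono) auto
    also have "\<dots> < CARD('v)" by (intro psubset_card_mono) auto
    finally show False using many F(2) by simp
  qed
  then obtain e where e: "e \<in> F" "v \<notin> e" by blast
  obtain i j where ij: "e = {i, j}" "i \<noteq> j" using F(1) e(1) by (auto simp: simple_graph_def card_2_iff)
  have ijv: "i \<noteq> v" "j \<noteq> v" "{i, v} \<in> F" "{j, v} \<in> F"
    using e ij stable[of j i] stable[of i j] by (auto simp: insert_commute)
  \<comment> \<open>Trade the edge \<open>e\<close> for the square of \<open>x\<^sub>v\<close>. By stability every non-neighbour \<open>k\<close> of \<open>v\<close> is a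
    non-neighbour of both ends of \<open>e\<close>, so each cubic gained except the cube of \<open>x\<^sub>v\<close> is paid for by
    a lost \<open>x\<^sub>i x\<^sub>j x\<^sub>k\<close>; the two lost multiples with \<open>k = i\<close> and \<open>k = j\<close> make the trade profitable.\<close>
  let ?G = "F - {e}"
  let ?S = "edge_monom ` ?G"
  let ?q = "Poly_Mapping.single v (2::nat)"
  have simple: "simple_graph ?G" using F(1) by (auto simp: simple_graph_def)
  have up: "upset ?S = edge_upset ?G" by (rule upset_edge_monoms[OF simple])
  define A where "A = {k. ?q + Poly_Mapping.single k 1 \<notin> upset ?S}"
  define B where "B = {k. edge_monom e + Poly_Mapping.single k 1 \<notin> upset ?S}"
  have A: "k = v \<or> {k, v} \<notin> F" if "k \<in> A" for k
  proof (rule ccontr)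
    assume k: "\<not> (k = v \<or> {k, v} \<notin> F)"
    then have "{k, v} \<in> ?G" using e by auto
    moreover have "{k, v} \<subseteq> Poly_Mapping.keys (?q + Poly_Mapping.single k 1)"
      by (auto simp: in_keys_iff lookup_add lookup_single when_def)
    moreover have "mon_deg (?q + Poly_Mapping.single k 1) = 3" by simp
    ultimately have "?q + Poly_Mapping.single k 1 \<in> edge_upset ?G"
      unfolding edge_upset_def by blast
    then show False using \<open>k \<in> A\<close> by (simp add: A_def up)
  qed
  have B: "k \<in> B" if "k = i \<or> k = j \<or> ({i, k} \<notin> F \<and> {j, k} \<notin> F)" for k
  proof (rule ccontr)
    assume "k \<notin> B"
    then obtain f where f: "f \<in> F" "f \<noteq> e" "f \<subseteq> Poly_Mapping.keys (edge_monom e + Poly_Mapping.single k 1)"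
      unfolding B_def up edge_upset_def by blast
    then have "f \<subseteq> {i, j, k}"
      by (auto simp: ij in_keys_iff lookup_add lookup_single when_def split: if_splits)
    moreover obtain a b where "f = {a, b}" "a \<noteq> b"
      using F(1) f(1) by (auto simp: simple_graph_def card_2_iff)
    \<comment> \<open>An edge other than \<open>e\<close> inside \<open>{i, j, k}\<close> must be
      \<open>{i, k}\<close> or \<open>{j, k}\<close> with \<open>k\<close> distinct from
      \<open>i\<close> and \<open>j\<close>.\<close>
    ultimately show False using that f(1,2) ij by (auto simp: insert_commute)
  qed
  have "(A - {v}) \<union> {i, j} \<subseteq> B"
  proof
    fix k assume k: "k \<in> (A - {v}) \<union> {i, j}"
    show "k \<in> B"
    proof (cases "k = i \<or> k = j")
      case False
      then have "k \<noteq> v" "{k, v} \<notin> F" using k A by auto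
      then have "{k, i} \<notin> F" "{k, j} \<notin> F" using stable ijv by blast+
      then show ?thesis by (intro B) (simp add: insert_commute)
    qed (use B in blast)
  qed
  moreover have "(A - {v}) \<inter> {i, j} = {}" using A ijv by blast
  ultimately have "card (A - {v}) + 2 \<le> card B"
    using card_Un_disjoint[of "A - {v}" "{i, j}"] card_mono[of B "(A - {v}) \<union> {i, j}"] ij(2) by simp
  moreover have "card A \<le> Suc (card (A - {v}))"
    by (metis card_Suc_Diff1 finite Diff_empty Diff_insert0 le_SucI order_refl)
  ultimately have "card A < card B" by simp
  have fin: "finite ?S" by simp
  have "card (upset (insert ?q ?S)) < card (upset (insert (edge_monom e) ?S))"
    using \<open>card A < card B\<close> unfolding card_upset_insert[OF fin] A_def B_def by simp
  also have "insert (edge_monom e) ?S = edge_monom ` F" using e by blast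
  also have "card (upset (edge_monom ` F)) \<le> card (upset (edge_monom ` E))"
    using F(3) by (simp add: upset_edge_monoms F(1) E)
  finally have "card (upset (insert ?q ?S)) < card (upset (edge_monom ` E))" .
  moreover have "?q \<notin> ?S"
  proof
    assume "?q \<in> ?S"
    then obtain f where "?q = edge_monom f" by blast
    from arg_cong[OF this, of "\<lambda>m. Poly_Mapping.lookup m v"] show False by (simp split: if_splits)
  qed
  then have "card (insert ?q ?S) = card E"
    using e F(2) card_Suc_Diff1[of F e] by (simp add: card_image[OF inj_edge_monom])
  moreover have "insert ?q ?S \<subseteq> {m. mon_deg m = 2}"
    using edge_monoms_deg[OF simple] by simp
  ultimately show ?thesis by blast
qed

theorem theorem3p4:
  fixes E :: "'v::finite set set"
  assumes "simple_graph E"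
  shows "gotzmann 2 (edge_ideal E :: ('v, 'k::field) mpoly set) \<longleftrightarrow> is_star E"
proof -
  let ?S = "edge_monom ` E"
  have card: "card ?S = card E" by (rule card_image[OF inj_edge_monom])
  have iff: "gotzmann 2 (edge_ideal E :: ('v, 'k) mpoly set) \<longleftrightarrow>
    (\<forall>T \<subseteq> {m :: 'v \<Rightarrow>\<^sub>0 nat. mon_deg m = 2}. card T = card E \<longrightarrow> card (upset ?S) \<le> card (upset T))"
    unfolding edge_ideal_eq_monom_ideal[OF assms] gotzmann_monom_ideal_iff[OF edge_monoms_deg[OF assms]]
      card ..
  show ?thesis
    unfolding iff
  proof
    assume star: "is_star E"
    show "\<forall>T \<subseteq> {m :: 'v \<Rightarrow>\<^sub>0 nat. mon_deg m = 2}. card T = card E \<longrightarrow> card (upset ?S) \<le> card (upset T)"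
    proof (intro allI impI)
      fix T :: "('v \<Rightarrow>\<^sub>0 nat) set"
      assume T: "T \<subseteq> {m. mon_deg m = 2}" "card T = card E"
      have "finite T" using T(1) finite_mon_deg_eq by (rule finite_subset)
      from card_upset_ge[OF this] card_upset_star[OF assms star] T(2)
      show "card (upset ?S) \<le> card (upset T)" by simp
    qed
  next
    assume min: "\<forall>T \<subseteq> {m :: 'v \<Rightarrow>\<^sub>0 nat. mon_deg m = 2}.
      card T = card E \<longrightarrow> card (upset ?S) \<le> card (upset T)"
    show "is_star E"
    proof (rule ccontr)
      assume not_star: "\<not> is_star E"
      show False
      \<comment> \<open>Below n edges, equally many multiples of one variable attain the least count
        and beat \<open>E\<close>. From n edges on, the competitor comes from trading an edge of a
        shifted graph for a square.\<close>
      proof (cases "card E < CARD('v)")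
        case True
        then obtain A :: "'v set" where A: "card A = card E"
          by (metis less_imp_le obtain_subset_with_card_n)
        fix v :: 'v
        let ?f = "\<lambda>a. Poly_Mapping.single v (1::nat) + Poly_Mapping.single a 1"
        have "card (?f ` A) = card E"
          using A inj_single_1 by (subst card_image) (auto simp: inj_on_def)
        moreover have "?f ` A \<subseteq> {m. mon_deg m = 2}" by auto
        ultimately have "card (upset ?S) \<le> card (upset (?f ` A))" using min by blast
        also have "\<dots> \<le> (\<Sum>i<card E. CARD('v) - i)" using card_upset_multiples_le[of v A] A by simp
        also have "\<dots> < card (upset ?S)" by (rule card_upset_not_star[OF assms not_star])
        finally show False by simp
      next
        case False
        then show False using ex_smaller_upset[OF assms] min by (meson not_le not_less)
      qed
    qed
  qed
qed

end
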